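(* Let $G$ be a group with identity element $e$, let $R=\bigoplus_{g\in G}R_g$ be a $G$-graded ring, and let $1=f_1+\dots+f_n$ in $R$, where the $f_i$ are orthogonal idempotents from $R_e$. If each graded corner ring $f_iRf_i$ is graded clean, and if $R$ has no nonzero homogeneous zero divisors, then $R$ is graded clean.
   Context: All rings are associative with identity. A ring $R$ is $G$-graded if $R=\bigoplus_{g\in G}R_g$ with additive subgroups $R_g$ satisfying $R_gR_h\subseteq R_{gh}$ for all $g,h\in G$; elements of $\bigcup_{g\in G}R_g$ are called homogeneous. One has $1\in R_e$. For an idempotent $f\in R_e$, the graded corner ring is the $G$-graded ring $fRf=\bigoplus_{g\in G}fR_gf$ (with identity $f$). A homogeneous element of a $G$-graded ring is graded clean if it is the sum of a homogeneous idempotent and a homogeneous unit; a $G$-graded ring is graded clean if every one of its homogeneous elements is graded clean. *)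

theory Defs
  imports "HOL-Algebra.Algebra"
begin

text \<open>
  Rings are not assumed commutative, and the zero ring is allowed (it occurs as the corner at
  the idempotent zero).
  The last axiom says that the ring is the internal direct sum of its components: every element
  has exactly one family of components with finite support. The families live in \<open>\<Pi>\<^sub>E\<close>, so they
  are pinned to \<open>undefined\<close> outside the group and uniqueness is meaningful.
\<close>

locale graded_ring = G: group G + R: ring R
  for G :: "('g, 'm) monoid_scheme" and R :: "('a, 'n) ring_scheme" +
  fixes A :: "'g \<Rightarrow> 'a set"
  assumes component_subgroup: "g \<in> carrier G \<Longrightarrow> additive_subgroup (A g) R"
    and component_mult:
      "\<lbrakk>g \<in> carrier G; h \<in> carrier G; a \<in> A g; b \<in> A h\<rbrakk> \<Longrightarrow> a \<otimes>\<^bsub>R\<^esub> b \<in> A (g \<otimes>\<^bsub>G\<^esub> h)"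
    and direct_sum:
      "r \<in> carrier R \<Longrightarrow>
        \<exists>!x. x \<in> (\<Pi>\<^sub>E g\<in>carrier G. A g) \<and> finite {g \<in> carrier G. x g \<noteq> \<zero>\<^bsub>R\<^esub>} \<and>
             r = (\<Oplus>\<^bsub>R\<^esub>g\<in>{g \<in> carrier G. x g \<noteq> \<zero>\<^bsub>R\<^esub>}. x g)"

definition homogeneous_elements :: "('g, 'm) monoid_scheme \<Rightarrow> ('g \<Rightarrow> 'a set) \<Rightarrow> 'a set"
  where "homogeneous_elements G A = (\<Union>g\<in>carrier G. A g)"

definition idempotent_elem :: "('a, 'n) ring_scheme \<Rightarrow> 'a \<Rightarrow> bool"
  where "idempotent_elem R x \<longleftrightarrow> x \<in> carrier R \<and> x \<otimes>\<^bsub>R\<^esub> x = x"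

text \<open>A left or right zero divisor; in particular zero is one unless the ring is trivial.\<close>

definition zero_divisor :: "('a, 'n) ring_scheme \<Rightarrow> 'a \<Rightarrow> bool"
  where "zero_divisor R a \<longleftrightarrow> a \<in> carrier R \<and>
    (\<exists>b\<in>carrier R. b \<noteq> \<zero>\<^bsub>R\<^esub> \<and> (a \<otimes>\<^bsub>R\<^esub> b = \<zero>\<^bsub>R\<^esub> \<or> b \<otimes>\<^bsub>R\<^esub> a = \<zero>\<^bsub>R\<^esub>))"

text \<open>The corner ring has the idempotent \<open>f\<close> as its identity, so \<open>Units\<close> of it are units with
  respect to \<open>f\<close>.\<close>

definition corner_ring :: "('a, 'n) ring_scheme \<Rightarrow> 'a \<Rightarrow> ('a, 'n) ring_scheme"
  where "corner_ring R f =
    R\<lparr>carrier := (\<lambda>r. f \<otimes>\<^bsub>R\<^esub> r \<otimes>\<^bsub>R\<^esub> f) ` carrier R, one := f\<rparr>"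

definition corner_grading :: "('a, 'n) ring_scheme \<Rightarrow> ('g \<Rightarrow> 'a set) \<Rightarrow> 'a \<Rightarrow> 'g \<Rightarrow> 'a set"
  where "corner_grading R A f g = (\<lambda>r. f \<otimes>\<^bsub>R\<^esub> r \<otimes>\<^bsub>R\<^esub> f) ` A g"

definition graded_clean_elem ::
  "('g, 'm) monoid_scheme \<Rightarrow> ('a, 'n) ring_scheme \<Rightarrow> ('g \<Rightarrow> 'a set) \<Rightarrow> 'a \<Rightarrow> bool"
  where "graded_clean_elem G R A a \<longleftrightarrow>
    (\<exists>p u. p \<in> homogeneous_elements G A \<and> idempotent_elem R p \<and>
           u \<in> homogeneous_elements G A \<and> u \<in> Units R \<and> a = p \<oplus>\<^bsub>R\<^esub> u)"

definition graded_clean ::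
  "('g, 'm) monoid_scheme \<Rightarrow> ('a, 'n) ring_scheme \<Rightarrow> ('g \<Rightarrow> 'a set) \<Rightarrow> bool"
  where "graded_clean G R A \<longleftrightarrow> (\<forall>a\<in>homogeneous_elements G A. graded_clean_elem G R A a)"

context graded_ring
begin

lemma component_closed: "g \<in> carrier G \<Longrightarrow> a \<in> A g \<Longrightarrow> a \<in> carrier R"
  by (meson additive_subgroup.a_Hcarr component_subgroup)

lemma corner_simps [simp]:
  "carrier (corner_ring R f) = (\<lambda>r. f \<otimes>\<^bsub>R\<^esub> r \<otimes>\<^bsub>R\<^esub> f) ` carrier R"
  "monoid.mult (corner_ring R f) = monoid.mult R" "monoid.one (corner_ring R f) = f"
  "ring.zero (corner_ring R f) = ring.zero R" "ring.add (corner_ring R f) = ring.add R"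
  by (simp_all add: corner_ring_def)

lemma corner_iff:
  assumes "idempotent_elem R f"
  shows "r \<in> carrier (corner_ring R f) \<longleftrightarrow>
    r \<in> carrier R \<and> f \<otimes>\<^bsub>R\<^esub> r = r \<and> r \<otimes>\<^bsub>R\<^esub> f = r"
proof -
  have f: "f \<in> carrier R" "f \<otimes>\<^bsub>R\<^esub> f = f" using assms by (auto simp: idempotent_elem_def)
  then have "f \<otimes>\<^bsub>R\<^esub> (f \<otimes>\<^bsub>R\<^esub> s \<otimes>\<^bsub>R\<^esub> f) = f \<otimes>\<^bsub>R\<^esub> s \<otimes>\<^bsub>R\<^esub> f"
    "(f \<otimes>\<^bsub>R\<^esub> s \<otimes>\<^bsub>R\<^esub> f) \<otimes>\<^bsub>R\<^esub> f = f \<otimes>\<^bsub>R\<^esub> s \<otimes>\<^bsub>R\<^esub> f" if "s \<in> carrier R" for s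
    using that by (metis R.m_assoc R.m_closed)+
  then show ?thesis using f by (auto simp: image_iff) metis
qed

lemma ring_corner:
  assumes idem: "idempotent_elem R f"
  shows "ring (corner_ring R f)"
proof -
  let ?C = "corner_ring R f"
  have f: "f \<in> carrier R" "f \<otimes>\<^bsub>R\<^esub> f = f" using idem by (auto simp: idempotent_elem_def)
  have iff: "r \<in> carrier ?C \<longleftrightarrow> r \<in> carrier R \<and> f \<otimes>\<^bsub>R\<^esub> r = r \<and> r \<otimes>\<^bsub>R\<^esub> f = r" for r
    by (rule corner_iff[OF idem])
  show ?thesis
  proof (rule ringI)
    show "abelian_group ?C"
    proof (rule abelian_groupI)
      fix x assume x: "x \<in> carrier ?C"
      then have "\<ominus>\<^bsub>R\<^esub> x \<in> carrier ?C" "\<ominus>\<^bsub>R\<^esub> x \<oplus>\<^bsub>R\<^esub> x = \<zero>\<^bsub>R\<^esub>"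
        unfolding iff using f by (auto simp: R.l_minus R.r_minus R.l_neg)
      then show "\<exists>y\<in>carrier ?C. y \<oplus>\<^bsub>?C\<^esub> x = \<zero>\<^bsub>?C\<^esub>" by (metis corner_simps(4,5))
    qed (unfold iff, auto simp: R.r_distr R.l_distr R.a_ac f)
    show "monoid ?C"
      by (rule monoidI) (unfold iff, auto simp: R.m_assoc f, simp flip: R.m_assoc add: f)
  qed (unfold iff, auto simp: R.r_distr R.l_distr)
qed

lemma corner_finsum:
  assumes idem: "idempotent_elem R f"
    and "finite I" "\<And>i. i \<in> I \<Longrightarrow> x i \<in> carrier (corner_ring R f)"
  shows "finsum (corner_ring R f) x I = finsum R x I"
proof -
  interpret C: ring "corner_ring R f" by (rule ring_corner[OF idem])
  have sub: "s \<in> carrier R" if "s \<in> carrier (corner_ring R f)" for s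
    using that corner_iff[OF idem] by blast
  show ?thesis using assms(2,3)
  proof (induction rule: finite_induct)
    case empty
    then show ?case by (simp only: C.finsum_empty R.finsum_empty corner_simps)
  next
    case (insert i I)
    have "finsum (corner_ring R f) x (insert i I) = x i \<oplus>\<^bsub>R\<^esub> finsum (corner_ring R f) x I"
      using insert by (subst C.finsum_insert) (auto simp del: corner_simps(1))
    also have "\<dots> = finsum R x (insert i I)"
      using insert sub by (subst R.finsum_insert) (auto simp del: corner_simps)
    finally show ?case .
  qed
qed

lemma component_sandwich:
  assumes "f \<in> A \<one>\<^bsub>G\<^esub>" "g \<in> carrier G" "r \<in> A g"
  shows "f \<otimes>\<^bsub>R\<^esub> r \<otimes>\<^bsub>R\<^esub> f \<in> A g"
  using component_mult[of g "\<one>\<^bsub>G\<^esub>" "f \<otimes>\<^bsub>R\<^esub> r" f] component_mult[of "\<one>\<^bsub>G\<^esub>" g f r] assms by simp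

theorem graded_ring_corner:
  assumes fe: "f \<in> A \<one>\<^bsub>G\<^esub>" and idem: "f \<otimes>\<^bsub>R\<^esub> f = f"
  shows "graded_ring G (corner_ring R f) (corner_grading R A f)"
proof -
  let ?C = "corner_ring R f" and ?B = "corner_grading R A f"
  have f: "f \<in> carrier R" using fe component_closed by blast
  then have I: "idempotent_elem R f" using idem by (simp add: idempotent_elem_def)
  interpret C: ring ?C by (rule ring_corner[OF I])
  have B: "r \<in> ?B g \<longleftrightarrow> r \<in> A g \<and> r \<in> carrier ?C" if g: "g \<in> carrier G" for g r
  proof
    show "r \<in> ?B g \<Longrightarrow> r \<in> A g \<and> r \<in> carrier ?C"
      using component_sandwich[OF fe g] component_closed[OF g] by (auto simp: corner_grading_def)
    assume "r \<in> A g \<and> r \<in> carrier ?C"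
    then show "r \<in> ?B g"
      unfolding corner_iff[OF I] corner_grading_def image_iff by metis
  qed
  have uminus: "inv\<^bsub>add_monoid ?C\<^esub> x = \<ominus>\<^bsub>R\<^esub> x" if "x \<in> carrier ?C" for x
  proof -
    have "\<ominus>\<^bsub>R\<^esub> x \<in> carrier ?C" "x \<in> carrier R"
      using that f unfolding corner_iff[OF I] by (auto simp: R.l_minus R.r_minus)
    then have "\<ominus>\<^bsub>?C\<^esub> x = \<ominus>\<^bsub>R\<^esub> x"
      using that by (intro C.minus_equality) (auto simp: R.l_neg simp del: corner_simps(1))
    then show ?thesis by (simp add: a_inv_def)
  qed
  show ?thesis
  proof (intro graded_ring.intro graded_ring_axioms.intro)
    show "group G" by (rule G.group_axioms)
    show "ring ?C" by (rule C.ring_axioms)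
    fix g assume g: "g \<in> carrier G"
    interpret S: additive_subgroup "A g" R by (rule component_subgroup[OF g])
    have neg: "\<ominus>\<^bsub>R\<^esub> x \<in> A g" if "x \<in> A g" for x
      using that by (simp add: S.a_inv_closed)
    show "additive_subgroup (?B g) ?C"
    proof (rule additive_subgroup.intro, rule subgroup.intro)
      show "?B g \<subseteq> carrier (add_monoid ?C)" using B[OF g] by auto
      fix x y assume "x \<in> ?B g" "y \<in> ?B g"
      then show "x \<otimes>\<^bsub>add_monoid ?C\<^esub> y \<in> ?B g"
        unfolding B[OF g] using C.a_closed[of x y] S.a_closed[of x y] by simp
    next
      show "\<one>\<^bsub>add_monoid ?C\<^esub> \<in> ?B g"
        unfolding B[OF g] using C.zero_closed S.zero_closed by simp
    next
      fix x assume "x \<in> ?B g"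
      then have x: "x \<in> A g" "x \<in> carrier ?C" unfolding B[OF g] by auto
      have "inv\<^bsub>add_monoid ?C\<^esub> x \<in> carrier ?C"
        using C.a_inv_closed[OF x(2)] by (simp add: a_inv_def)
      then show "inv\<^bsub>add_monoid ?C\<^esub> x \<in> ?B g"
        unfolding B[OF g] using neg[OF x(1)] uminus[OF x(2)] by simp
    qed
  next
    fix g h a b assume "g \<in> carrier G" "h \<in> carrier G" "a \<in> ?B g" "b \<in> ?B h"
    then show "a \<otimes>\<^bsub>?C\<^esub> b \<in> ?B (g \<otimes>\<^bsub>G\<^esub> h)"
      using B component_mult[of g h a b] C.m_closed[of a b] by (simp del: corner_simps(1))
  next
    fix r assume r: "r \<in> carrier ?C"
    then have rR: "r \<in> carrier R" "f \<otimes>\<^bsub>R\<^esub> r = r" "r \<otimes>\<^bsub>R\<^esub> f = r" unfolding corner_iff[OF I] by auto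
    let ?supp = "\<lambda>x. {g \<in> carrier G. x g \<noteq> \<zero>\<^bsub>R\<^esub>}"
    let ?P = "\<lambda>x. x \<in> (\<Pi>\<^sub>E g\<in>carrier G. A g) \<and> finite (?supp x) \<and> r = finsum R x (?supp x)"
    let ?Q = "\<lambda>x. x \<in> (\<Pi>\<^sub>E g\<in>carrier G. ?B g) \<and> finite (?supp x) \<and> r = finsum ?C x (?supp x)"
    obtain x where x: "?P x" and uniq: "\<And>y. ?P y \<Longrightarrow> y = x"
      using direct_sum[OF rR(1)] by blast
    have QP: "?P y" if y: "?Q y" for y
    proof -
      have "finsum ?C y (?supp y) = finsum R y (?supp y)"
        using y B by (intro corner_finsum[OF I]) (auto simp del: corner_simps)
      moreover have "y \<in> (\<Pi>\<^sub>E g\<in>carrier G. A g)" using y B by (auto simp: PiE_iff)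
      ultimately show ?thesis using y by simp
    qed
    define z where "z = (\<lambda>g\<in>carrier G. f \<otimes>\<^bsub>R\<^esub> x g \<otimes>\<^bsub>R\<^esub> f)"
    have xc: "x g \<in> carrier R" if "g \<in> carrier G" for g
      using that x component_closed by (auto simp: PiE_iff)
    have zB: "z \<in> (\<Pi>\<^sub>E g\<in>carrier G. ?B g)"
      using x by (auto simp: z_def corner_grading_def PiE_iff)
    have zc: "z g \<in> carrier R" "z g \<in> carrier ?C" if "g \<in> carrier G" for g
      using zB that B corner_iff[OF I] by (auto simp: PiE_iff simp del: corner_simps)
    have sub: "?supp z \<subseteq> ?supp x" using f by (auto simp: z_def)
    have fin: "finite (?supp z)" using sub x finite_subset by blast
    have "r = f \<otimes>\<^bsub>R\<^esub> finsum R x (?supp x) \<otimes>\<^bsub>R\<^esub> f" using x rR by metis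
    also have "\<dots> = finsum R (\<lambda>g. f \<otimes>\<^bsub>R\<^esub> x g \<otimes>\<^bsub>R\<^esub> f) (?supp x)"
      using x f xc by (simp add: R.finsum_rdistr R.finsum_ldistr Pi_def)
    also have "\<dots> = finsum R z (?supp x)"
      using f xc by (intro R.finsum_cong') (auto simp: z_def)
    also have "\<dots> = finsum R z (?supp z)"
      using x sub zc by (intro R.add.finprod_mono_neutral_cong_right) auto
    also have "\<dots> = finsum ?C z (?supp z)"
      using fin zc by (intro corner_finsum[OF I, symmetric]) auto
    finally have Qz: "?Q z" using zB fin by simp
    have "y = z" if "?Q y" for y
      using uniq[OF QP[OF that]] uniq[OF QP[OF Qz]] by (rule trans[OF _ sym])
    then have "\<exists>!x. ?Q x" using Qz by (rule_tac ex1I[of ?Q z])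
    then show "\<exists>!x. x \<in> (\<Pi>\<^sub>E g\<in>carrier G. ?B g) \<and> finite {g \<in> carrier G. x g \<noteq> \<zero>\<^bsub>?C\<^esub>} \<and>
             r = (\<Oplus>\<^bsub>?C\<^esub>g\<in>{g \<in> carrier G. x g \<noteq> \<zero>\<^bsub>?C\<^esub>}. x g)"
      unfolding corner_simps(4) .
  qed
qed

end

end

theory Submission
  imports Defs
begin

text \<open>
  Without nonzero homogeneous zero divisors the decomposition of the identity is trivial. An
  idempotent \<open>f\<close> satisfies \<open>f (1 - f) = 0\<close>, so a nonzero homogeneous one must be the identity
  (\<open>nonzero_homogeneous_idempotent_eq_one\<close>). If \<open>1 \<noteq> 0\<close>, the \<open>f\<^sub>i\<close> cannot all vanish, since they
  sum to \<open>1\<close>; hence some \<open>f\<^sub>i\<close> is \<open>1\<close>, and the graded corner ring at that \<open>f\<^sub>i\<close> is \<open>R\<close> itself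
  (\<open>graded_clean_corner_one\<close>). If \<open>1 = 0\<close>, the only element is \<open>0\<close>, which is at once a homogeneous
  idempotent and a homogeneous unit (\<open>graded_clean_trivial\<close>).
\<close>

context graded_ring
begin

lemma nonzero_homogeneous_idempotent_eq_one:
  assumes no_zero_divisor: "\<not> (\<exists>a \<in> homogeneous_elements G A. a \<noteq> \<zero>\<^bsub>R\<^esub> \<and> zero_divisor R a)"
    and hom: "f \<in> homogeneous_elements G A"
    and idem: "idempotent_elem R f"
    and nz: "f \<noteq> \<zero>\<^bsub>R\<^esub>"
  shows "f = \<one>\<^bsub>R\<^esub>"
proof (rule ccontr)
  assume ne: "f \<noteq> \<one>\<^bsub>R\<^esub>"
  have f: "f \<in> carrier R" "f \<otimes>\<^bsub>R\<^esub> f = f" using idem by (auto simp: idempotent_elem_def)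
  have "f \<otimes>\<^bsub>R\<^esub> (\<one>\<^bsub>R\<^esub> \<ominus>\<^bsub>R\<^esub> f) = \<zero>\<^bsub>R\<^esub>"
    using f by (simp add: a_minus_def R.r_distr R.r_minus R.r_neg)
  moreover have "\<one>\<^bsub>R\<^esub> \<ominus>\<^bsub>R\<^esub> f \<noteq> \<zero>\<^bsub>R\<^esub>" using f ne by simp
  moreover have "\<one>\<^bsub>R\<^esub> \<ominus>\<^bsub>R\<^esub> f \<in> carrier R" using f by simp
  ultimately have "zero_divisor R f" unfolding zero_divisor_def using f by blast
  then show False using no_zero_divisor hom nz by blast
qed

lemma graded_clean_corner_one:
  "graded_clean G (corner_ring R \<one>\<^bsub>R\<^esub>) (corner_grading R A \<one>\<^bsub>R\<^esub>) \<longleftrightarrow> graded_clean G R A"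
proof -
  have "(\<lambda>r. \<one>\<^bsub>R\<^esub> \<otimes>\<^bsub>R\<^esub> r \<otimes>\<^bsub>R\<^esub> \<one>\<^bsub>R\<^esub>) ` B = B" if "B \<subseteq> carrier R" for B
    using that by (force simp: image_iff)
  then have "corner_ring R \<one>\<^bsub>R\<^esub> = R"
    and "corner_grading R A \<one>\<^bsub>R\<^esub> g = A g" if "g \<in> carrier G" for g
    using component_closed that by (auto simp: corner_ring_def corner_grading_def subset_iff)
  then have "corner_ring R \<one>\<^bsub>R\<^esub> = R"
    and "homogeneous_elements G (corner_grading R A \<one>\<^bsub>R\<^esub>) = homogeneous_elements G A"
    by (auto simp: homogeneous_elements_def)
  then show ?thesis by (simp add: graded_clean_def graded_clean_elem_def)
qed

lemma graded_clean_trivial: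
  assumes "\<one>\<^bsub>R\<^esub> = \<zero>\<^bsub>R\<^esub>"
  shows "graded_clean G R A"
proof -
  have carrier: "carrier R = {\<zero>\<^bsub>R\<^esub>}" using assms by (simp add: R.carrier_one_zero)
  have "\<zero>\<^bsub>R\<^esub> \<in> A \<one>\<^bsub>G\<^esub>"
    using additive_subgroup.zero_closed[OF component_subgroup[OF G.one_closed]] .
  then have hom: "\<zero>\<^bsub>R\<^esub> \<in> homogeneous_elements G A" by (auto simp: homogeneous_elements_def)
  have unit: "\<zero>\<^bsub>R\<^esub> \<in> Units R" using R.Units_one_closed assms by simp
  have "a = \<zero>\<^bsub>R\<^esub>" if "a \<in> homogeneous_elements G A" for a
    using that component_closed carrier by (auto simp: homogeneous_elements_def)
  moreover have "graded_clean_elem G R A \<zero>\<^bsub>R\<^esub>"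
    unfolding graded_clean_elem_def using hom unit
    by (intro exI[of _ "\<zero>\<^bsub>R\<^esub>"]) (simp add: idempotent_elem_def)
  ultimately show ?thesis unfolding graded_clean_def by metis
qed

end

theorem theorem3p18:
  fixes G :: "('g, 'm) monoid_scheme"
    and R :: "('a, 'n) ring_scheme"
    and A :: "'g \<Rightarrow> 'a set"
    and n :: nat
    and f :: "nat \<Rightarrow> 'a"
  assumes "graded_ring G R A"
    and "\<And>i. i \<in> {1..n} \<Longrightarrow> f i \<in> A \<one>\<^bsub>G\<^esub>"
    and "\<And>i. i \<in> {1..n} \<Longrightarrow> idempotent_elem R (f i)"
    and "\<And>i j. \<lbrakk>i \<in> {1..n}; j \<in> {1..n}; i \<noteq> j\<rbrakk> \<Longrightarrow> f i \<otimes>\<^bsub>R\<^esub> f j = \<zero>\<^bsub>R\<^esub>"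
    and "\<one>\<^bsub>R\<^esub> = (\<Oplus>\<^bsub>R\<^esub>i\<in>{1..n}. f i)"
    and "\<And>i. i \<in> {1..n} \<Longrightarrow> graded_clean G (corner_ring R (f i)) (corner_grading R A (f i))"
    and "\<not> (\<exists>a \<in> homogeneous_elements G A. a \<noteq> \<zero>\<^bsub>R\<^esub> \<and> zero_divisor R a)"
  shows "graded_clean G R A"
proof -
  interpret graded_ring G R A by (rule assms(1))
  show ?thesis
  proof (cases "\<one>\<^bsub>R\<^esub> = \<zero>\<^bsub>R\<^esub>")
    case True
    then show ?thesis by (rule graded_clean_trivial)
  next
    case False
    have "\<exists>i\<in>{1..n}. f i \<noteq> \<zero>\<^bsub>R\<^esub>"
    proof (rule ccontr)
      assume "\<not> (\<exists>i\<in>{1..n}. f i \<noteq> \<zero>\<^bsub>R\<^esub>)"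
      then have "(\<Oplus>\<^bsub>R\<^esub>i\<in>{1..n}. f i) = \<zero>\<^bsub>R\<^esub>" by (intro R.add.finprod_one_eqI) auto
      then show False using assms(5) False by simp
    qed
    then obtain i where i: "i \<in> {1..n}" "f i \<noteq> \<zero>\<^bsub>R\<^esub>" by blast
    have "f i \<in> homogeneous_elements G A"
      using assms(2)[OF i(1)] by (auto simp: homogeneous_elements_def)
    then have "f i = \<one>\<^bsub>R\<^esub>"
      using nonzero_homogeneous_idempotent_eq_one[OF assms(7) _ assms(3)[OF i(1)] i(2)] by blast
    then show ?thesis using assms(6)[OF i(1)] by (simp add: graded_clean_corner_one)
  qed
qed

end
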